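(* Let $(G,p)$ and $(G,p')$ be tensegrity frameworks on $n$ vertices (in $\mathbb{R}^r$ and $\mathbb{R}^{r'}$ respectively) with configuration matrices $P$ and $P'$, where each configuration has its centroid at the origin, i.e., $P^Te=0$ and $P'^Te=0$. Then $(G,p')$ is dominated by $(G,p)$ if and only if $$P'P'^T-PP^T=\mathcal{E}(y)+xe^T+ex^T$$ for some $y=(y_{ij})\in\mathbb{R}^{|\overline{E}|+|C|+|S|}$ and $x=(x_i)\in\mathbb{R}^n$ such that $y_{ij}\ge 0$ for all $\{i,j\}\in C$, $y_{ij}\le 0$ for all $\{i,j\}\in S$, and $$x=-\frac{1}{n}\mathcal{E}(y)e+\frac{1}{2n^2}\left(e^T\mathcal{E}(y)e\right)e.$$
   Context: A tensegrity graph $G=(V,E)$ is a simple connected graph with $V=\{1,\ldots,n\}$ in which each edge is labelled as either a bar, a cable or a strut; $B$, $C$, $S$ denote the sets of bars, cables and struts, so $E=B\cup C\cup S$ (disjoint union). $\overline{E}$ denotes the set of missing edges, $\overline{E}=\{\{i,j\}: i\ne j,\ \{i,j\}\notin E\}$. A tensegrity framework $(G,p)$ in $\mathbb{R}^r$ is a tensegrity graph $G$ together with a configuration $p=(p^1,\ldots,p^n)$ of points $p^i\in\mathbb{R}^r$. Its configuration matrix $P$ is the $n\times r$ matrix whose $i$th row is $(p^i)^T$. $(G,p')$ is dominated by $(G,p)$ if $\|p'^i-p'^j\|^2=\|p^i-p^j\|^2$ for each $\{i,j\}\in B$, $\|p'^i-p'^j\|^2\le\|p^i-p^j\|^2$ for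 each $\{i,j\}\in C$, and $\|p'^i-p'^j\|^2\ge\|p^i-p^j\|^2$ for each $\{i,j\}\in S$. $e$ is the all-ones vector in $\mathbb{R}^n$, $e^i$ is the $i$th standard unit vector in $\mathbb{R}^n$, $E^{ij}=e^i(e^j)^T+e^j(e^i)^T$, and for $y=(y_{ij})$ indexed by $\overline{E}\cup C\cup S$, $\mathcal{E}(y)=\sum_{\{i,j\}\in\overline{E}\cup C\cup S}y_{ij}E^{ij}$. *)

theory Defs
  imports "HOL-Analysis.Analysis"
begin

text \<open>The vertices are the elements of a finite type \<open>'n\<close>, so that \<open>n = CARD('n)\<close>, and an edge is a
  two-element set of vertices.\<close>

definition tensegrity_graph :: "'n::finite set set \<Rightarrow> 'n set set \<Rightarrow> 'n set set \<Rightarrow> bool" where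
  "tensegrity_graph B C S \<longleftrightarrow>
     (\<forall>d \<in> B \<union> C \<union> S. card d = 2) \<and>
     B \<inter> C = {} \<and> B \<inter> S = {} \<and> C \<inter> S = {} \<and>
     (\<forall>u v. (u, v) \<in> {(i, j). {i, j} \<in> B \<union> C \<union> S}\<^sup>*)"

definition missing_edges :: "'n set set \<Rightarrow> 'n set set" where
  "missing_edges E = {{i, j} | i j. i \<noteq> j \<and> {i, j} \<notin> E}"

definition dominated_by ::
  "'n set set \<Rightarrow> 'n set set \<Rightarrow> 'n set set \<Rightarrow> ('n \<Rightarrow> real^'s) \<Rightarrow> ('n \<Rightarrow> real^'r) \<Rightarrow> bool" where
  "dominated_by B C S p' p \<longleftrightarrow>
     (\<forall>i j. {i, j} \<in> B \<longrightarrow> (norm (p' i - p' j))\<^sup>2 = (norm (p i - p j))\<^sup>2) \<and>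
     (\<forall>i j. {i, j} \<in> C \<longrightarrow> (norm (p' i - p' j))\<^sup>2 \<le> (norm (p i - p j))\<^sup>2) \<and>
     (\<forall>i j. {i, j} \<in> S \<longrightarrow> (norm (p' i - p' j))\<^sup>2 \<ge> (norm (p i - p j))\<^sup>2)"

definition config_matrix :: "('n::finite \<Rightarrow> real^'r) \<Rightarrow> real^'r^'n" where
  "config_matrix p = (\<chi> i. p i)"

abbreviation ones :: "real^'n" where
  "ones \<equiv> vec 1"

text \<open>The rank-one matrix \<open>u v\<^sup>T\<close>.\<close>

definition outer :: "real^'m \<Rightarrow> real^'n \<Rightarrow> real^'n^'m" where
  "outer u v = (\<chi> i j. u $ i * v $ j)"

definition E_mat :: "'n::finite \<Rightarrow> 'n \<Rightarrow> real^'n^'n" where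
  "E_mat i j = outer (axis i 1) (axis j 1) + outer (axis j 1) (axis i 1)"

lemma E_mat_commute: "E_mat i j = E_mat j i"
  by (simp add: E_mat_def add.commute)

text \<open>\<open>E_mat\<close> as a function of the unordered pair; well defined because \<open>E_mat\<close> is symmetric.\<close>

definition E_edge :: "'n::finite set \<Rightarrow> real^'n^'n" where
  "E_edge d = (THE A. \<exists>i j. d = {i, j} \<and> A = E_mat i j)"

lemma E_edge_doubleton: "E_edge {i, j} = E_mat i j"
  unfolding E_edge_def
  by (rule the_equality) (auto simp: doubleton_eq_iff E_mat_commute)

text \<open>The index set of \<open>y\<close> is \<open>missing_edges (B \<union> C \<union> S) \<union> C \<union> S\<close>; values of \<open>y\<close> outside it play
  no role.\<close>

definition calE ::
  "'n::finite set set \<Rightarrow> 'n set set \<Rightarrow> 'n set set \<Rightarrow> ('n set \<Rightarrow> real) \<Rightarrow> real^'n^'n" where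
  "calE B C S y = (\<Sum>d \<in> missing_edges (B \<union> C \<union> S) \<union> C \<union> S. y d *\<^sub>R E_edge d)"

end

theory Submission
  imports Defs
begin

text \<open>Put \<open>M = P'P'\<^sup>T - PP\<^sup>T\<close>. The change of the squared distance between \<open>i\<close> and \<open>j\<close> is
  \<open>M\<^sub>i\<^sub>i + M\<^sub>j\<^sub>j - 2 M\<^sub>i\<^sub>j\<close>, which annihilates the terms \<open>xe\<^sup>T + ex\<^sup>T\<close> and equals
  \<open>-2 y\<^sub>i\<^sub>j\<close> on \<open>\<E>(y)\<close>. Conversely one takes \<open>x\<^sub>i = M\<^sub>i\<^sub>i / 2\<close> and lets \<open>y\<^sub>i\<^sub>j\<close> be minus half the
  change of the squared distance; the formula for \<open>x\<close> then follows from \<open>M e = 0\<close>.\<close>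

lemma E_edge_nth:
  assumes "card d = 2"
  shows "E_edge d $ i $ j = (if d = {i, j} then 1 else 0)"
proof -
  obtain a b where "d = {a, b}" "a \<noteq> b"
    using assms by (auto simp: card_2_iff)
  then show ?thesis
    by (auto simp: E_edge_doubleton E_mat_def outer_def axis_def doubleton_eq_iff)
qed

text \<open>By disjointness of the labels, the index set consists of exactly the two-element vertex
  sets outside \<open>B\<close>. So at most one summand reaches a given entry, and the diagonal is
  zero.\<close>

lemma calE_nth:
  fixes B C S :: "'n::finite set set"
  assumes "tensegrity_graph B C S"
  shows "calE B C S y $ i $ j = (if i \<noteq> j \<and> {i, j} \<notin> B then y {i, j} else 0)"
proof -
  let ?K = "missing_edges (B \<union> C \<union> S) \<union> C \<union> S"
  have K2: "card d = 2" if "d \<in> ?K" for d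
    using that assms by (auto simp: tensegrity_graph_def missing_edges_def)
  have Kmem: "{i, j} \<in> ?K \<longleftrightarrow> i \<noteq> j \<and> {i, j} \<notin> B"
    using K2[of "{i, j}"] assms
    by (auto simp: tensegrity_graph_def missing_edges_def doubleton_eq_iff insert_commute)
  have "calE B C S y $ i $ j = (\<Sum>d\<in>?K. y d * E_edge d $ i $ j)"
    by (simp add: calE_def)
  also have "\<dots> = (\<Sum>d\<in>?K. if d = {i, j} then y d else 0)"
    using K2 by (intro sum.cong) (auto simp: E_edge_nth)
  also have "\<dots> = (if {i, j} \<in> ?K then y {i, j} else 0)"
    by (rule sum.delta) simp
  finally show ?thesis
    using Kmem by simp
qed

definition gram :: "('n::finite \<Rightarrow> real^'r) \<Rightarrow> real^'n^'n" where
  "gram p = config_matrix p ** transpose (config_matrix p)"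

lemma gram_nth: "gram p $ i $ j = p i \<bullet> p j"
  by (simp add: gram_def config_matrix_def matrix_matrix_mult_def transpose_def inner_vec_def)

lemma gram_mult_ones:
  assumes "transpose (config_matrix p) *v ones = 0"
  shows "gram p *v ones = 0"
  using assms by (simp add: gram_def flip: matrix_vector_mul_assoc)

lemma norm_diff_gram:
  "(norm (p i - p j))\<^sup>2 = gram p $ i $ i + gram p $ j $ j - 2 * gram p $ i $ j"
  by (simp add: gram_nth power2_norm_eq_inner inner_diff_left inner_diff_right inner_commute)

lemma outer_mult_vec: "outer u v *v w = (v \<bullet> w) *\<^sub>R u"
  by (simp add: vec_eq_iff outer_def matrix_vector_mult_def inner_vec_def
      sum_distrib_left sum_distrib_right mult_ac)

lemma one_inner_one: "(1 :: real^'n) \<bullet> 1 = real CARD('n::finite)"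
  by (simp add: inner_vec_def)

text \<open>Expanding the product gives \<open>A e + n x + (x \<bullet> e) e = 0\<close>. Pairing
  this with \<open>e\<close> yields \<open>e \<bullet> A e = - 2 n (x \<bullet> e)\<close>, which
  eliminates the unknown \<open>x \<bullet> e\<close>.\<close>

lemma offset_from_zero_row_sums:
  fixes A :: "real^'n::finite^'n" and x :: "real^'n"
  assumes "(A + outer x ones + outer ones x) *v ones = 0"
  shows "x = - (1 / real CARD('n)) *\<^sub>R (A *v ones)
    + (1 / (2 * (real CARD('n))\<^sup>2) * (ones \<bullet> (A *v ones))) *\<^sub>R ones"
proof -
  let ?n = "real CARD('n)" and ?s = "x \<bullet> ones"
  have "A *v ones + (?n *\<^sub>R x + ?s *\<^sub>R ones) = 0"
    using assms
    by (simp add: matrix_vector_mult_add_rdistrib outer_mult_vec one_inner_one add.assoc)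
  then have Ae: "A *v ones = - (?n *\<^sub>R x + ?s *\<^sub>R ones)"
    by (simp only: eq_neg_iff_add_eq_0)
  have eAe: "ones \<bullet> (A *v ones) = - 2 * ?n * ?s"
    unfolding Ae by (simp add: inner_diff_right one_inner_one inner_commute)
  have "?n > 0" by simp
  then show ?thesis
    unfolding eAe unfolding Ae
    by (simp add: vec_eq_iff field_simps power2_eq_square)
qed

lemma norm_diff_change:
  fixes B C S :: "'n::finite set set"
    and p :: "'n \<Rightarrow> real^'r" and p' :: "'n \<Rightarrow> real^'s"
  assumes "tensegrity_graph B C S" and "i \<noteq> j"
    and "gram p' - gram p = calE B C S y + outer x ones + outer ones x"
  shows "(norm (p' i - p' j))\<^sup>2 - (norm (p i - p j))\<^sup>2 = (if {i, j} \<in> B then 0 else - 2 * y {i, j})"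
proof -
  have M: "gram p' $ k $ l - gram p $ k $ l = calE B C S y $ k $ l + x $ k + x $ l" for k l
    using assms(3) by (simp add: vec_eq_iff outer_def)
  show ?thesis
    \<comment> \<open>The two diagonal instances give \<open>2 x_i\<close> and \<open>2 x_j\<close>,
      which cancel against twice the instance at \<open>(i, j)\<close>.\<close>
    using M[of i i] M[of j j] M[of i j] \<open>i \<noteq> j\<close>
    by (auto simp: norm_diff_gram calE_nth[OF assms(1)] split: if_splits)
qed

theorem lemma4p1:
  fixes B C S :: "'n::finite set set"
    and p :: "'n \<Rightarrow> real^'r" and p' :: "'n \<Rightarrow> real^'s"
  assumes "tensegrity_graph B C S"
    and "transpose (config_matrix p) *v ones = 0"
    and "transpose (config_matrix p') *v ones = 0"
  shows "dominated_by B C S p' p \<longleftrightarrow>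
    (\<exists>(y :: 'n set \<Rightarrow> real) (x :: real^'n).
       config_matrix p' ** transpose (config_matrix p')
         - config_matrix p ** transpose (config_matrix p)
         = calE B C S y + outer x ones + outer ones x \<and>
       (\<forall>i j. {i, j} \<in> C \<longrightarrow> y {i, j} \<ge> 0) \<and>
       (\<forall>i j. {i, j} \<in> S \<longrightarrow> y {i, j} \<le> 0) \<and>
       x = - (1 / real CARD('n)) *\<^sub>R (calE B C S y *v ones)
           + (1 / (2 * (real CARD('n))\<^sup>2) * (ones \<bullet> (calE B C S y *v ones))) *\<^sub>R ones)" (is "?lhs \<longleftrightarrow> ?rhs")
proof
  have neq: "i \<noteq> j" if "{i, j} \<in> B \<union> C \<union> S" for i j
    using that assms(1) by (force simp: tensegrity_graph_def)
  have disj: "B \<inter> C = {}" "B \<inter> S = {}"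
    using assms(1) by (auto simp: tensegrity_graph_def)
  {
    assume dom: "dominated_by B C S p' p"
    define \<Delta> where "\<Delta> i j = (norm (p' i - p' j))\<^sup>2 - (norm (p i - p j))\<^sup>2" for i j
    \<comment> \<open>A symmetric expression in the elements of \<open>d\<close>, so that no orientation of the edge has to be
      chosen; on \<open>d = {i, j}\<close> it is \<open>- \<Delta> i j / 2\<close>.\<close>
    define y where "y d = - (\<Sum>i\<in>d. \<Sum>j\<in>d. \<Delta> i j) / 4" for d
    \<comment> \<open>Forced by the diagonal, where \<open>calE\<close> vanishes and the offset
      terms add up to \<open>2 x_i\<close>.\<close>
    define x :: "real^'n" where "x = (\<chi> i. (gram p' - gram p) $ i $ i / 2)"
    \<comment> \<open>The double sum counts \<open>\<Delta> i j\<close> twice and its diagonal terms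
      vanish, hence the divisor 4.\<close>
    have y: "y {i, j} = - \<Delta> i j / 2" if "i \<noteq> j" for i j
      using that by (simp add: y_def \<Delta>_def norm_minus_commute)
    have yB: "\<Delta> i j = 0" if "{i, j} \<in> B" for i j
      using that dom by (auto simp: dominated_by_def \<Delta>_def)
    have M: "gram p' - gram p = calE B C S y + outer x ones + outer ones x"
    proof -
      \<comment> \<open>Off the diagonal the left side is
        \<open>x_i + x_j - \<Delta> i j / 2\<close>. On a bar, where \<open>calE\<close> has entry
        0, domination makes \<open>\<Delta> i j\<close> vanish too.\<close>
      have "(gram p' - gram p) $ i $ j = calE B C S y $ i $ j + x $ i + x $ j" for i j
        using y[of i j] yB[of i j]
        by (auto simp: calE_nth[OF assms(1)] x_def \<Delta>_def norm_diff_gram field_simps)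
      then show ?thesis
        by (simp add: vec_eq_iff outer_def)
    qed
    \<comment> \<open>Both Gram matrices annihilate \<open>ones\<close> because the centroids are at
      the origin; this determines \<open>x\<close> from \<open>y\<close>.\<close>
    have "(calE B C S y + outer x ones + outer ones x) *v ones = 0"
      unfolding M[symmetric] using assms(2,3)
      by (simp only: matrix_vector_mult_diff_rdistrib gram_mult_ones diff_0_right)
    note x = offset_from_zero_row_sums[OF this]
    have "y {i, j} \<ge> 0" if "{i, j} \<in> C" for i j
      using that dom neq[of i j] by (auto simp: y dominated_by_def \<Delta>_def)
    moreover have "y {i, j} \<le> 0" if "{i, j} \<in> S" for i j
      using that dom neq[of i j] by (auto simp: y dominated_by_def \<Delta>_def)
    ultimately show ?rhs
      using M x unfolding gram_def by blast
  }
  assume ?rhs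
  then obtain y x where M: "gram p' - gram p = calE B C S y + outer x ones + outer ones x"
    and yC: "\<forall>i j. {i, j} \<in> C \<longrightarrow> y {i, j} \<ge> 0" and yS: "\<forall>i j. {i, j} \<in> S \<longrightarrow> y {i, j} \<le> 0"
    unfolding gram_def by blast
  note change = norm_diff_change[OF assms(1) _ M]
  show "dominated_by B C S p' p"
    unfolding dominated_by_def
  proof (intro conjI allI impI)
    fix i j
    show "(norm (p' i - p' j))\<^sup>2 = (norm (p i - p j))\<^sup>2" if "{i, j} \<in> B"
      using that change[of i j] neq[of i j] by simp
    show "(norm (p' i - p' j))\<^sup>2 \<le> (norm (p i - p j))\<^sup>2" if "{i, j} \<in> C"
    proof -
      \<comment> \<open>A cable is not a bar, so the change of its squared length is
        \<open>- 2 * y {i, j}\<close>.\<close>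
      have "{i, j} \<notin> B" "i \<noteq> j" "0 \<le> y {i, j}"
        using that disj neq yC by blast+
      then show ?thesis
        using change[of i j] by argo
    qed
    show "(norm (p' i - p' j))\<^sup>2 \<ge> (norm (p i - p j))\<^sup>2" if "{i, j} \<in> S"
    proof -
      have "{i, j} \<notin> B" "i \<noteq> j" "y {i, j} \<le> 0"
        using that disj neq yS by blast+
      then show ?thesis
        using change[of i j] by argo
    qed
  qed
qed

end
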